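(* Let $L$ be a reduced, $1$-compact, compactly generated multiplicative lattice such that the set $L_*$ of compact elements of $L$ is multiplicatively closed, and suppose that $\mathrm{Clique}(\Gamma^m(L)) < \infty$. Then the number of minimal prime elements of $L$ is finite, say $n$, and $\chi(\Gamma^m(L)) = \mathrm{Clique}(\Gamma^m(L)) = n$.
   Context: A multiplicative lattice is a complete lattice $L$ (least element $0$, greatest element $1$) with a binary operation $\cdot$ satisfying: (1) $a\cdot b=b\cdot a$; (2) $a\cdot(b\cdot c)=(a\cdot b)\cdot c$; (3) $a\cdot\left(\bigvee_\alpha b_\alpha\right)=\bigvee_\alpha (a\cdot b_\alpha)$ for arbitrary joins; (4) $a\cdot b\le a\wedge b$; (5) $a\cdot 1=a$. An element $a\in L$ is nilpotent if $a^n=0$ for some positive integer $n$ (powers with respect to $\cdot$); $L$ is reduced if $0$ is its only nilpotent element. An element $c\in L$ is compact if $c\le\bigvee_\alpha a_\alpha$ implies $c\le\bigvee_{i=1}^n a_{\alpha_i}$ for finitely many indices; $L_*$ denotes the set of compact elements. $L$ is compactly generated if every element is a join of compact elements, and $1$-compact if $1$ is compact. $L_*$ is multiplicatively closed if $s_1,s_2\in L_*$ implies $s_1\cdot s_2\in L_*$. An element $p\ne 1$ of $L$ is prime if $a\cdot b\le p$ implies $a\le p$ or $b\le p$. A minimal prime element is a prime element that is minimal (with respect to $\le$) among the prime elements of $L$. The zero-divisor graph $\Gamma^m(L)$ is the simple undirected graph with vertex set $\{x\in L : x\neq 0 \text{ and } x\cdot y=0 \text{ for some } y\in L,\ y\ne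 0\}$, in which two distinct vertices $a,b$ are adjacent if and only if $a\cdot b=0$. $\chi(G)$ denotes the chromatic number of a graph $G$, and $\mathrm{Clique}(G)$ denotes its clique number, i.e. the supremum of the sizes of complete subgraphs of $G$.
   Formalization: The equality with n is claimed only when 0 is not a prime element: if 0 is prime (e.g. L = {0,1}) the zero-divisor graph is empty, so χ = Clique = 0 while n = 1; finiteness of the set of minimal primes and χ = Clique are claimed in all cases. *)

theory Defs
  imports "HOL-Library.Extended_Nat" "HOL-Library.Ramsey"
begin

text \<open>
  The monoid unit \<open>1\<close> is identified with the greatest element, so \<open>a * 1 = a\<close> is the axiom that
  the greatest element is neutral, and \<open>a ^ n\<close> is the \<open>n\<close>-th power for the lattice multiplication.
  The zero of the lattice is \<open>bot\<close>.
\<close>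

class multiplicative_lattice = complete_lattice + comm_monoid_mult +
  assumes mult_Sup: "a * Sup B = (SUP b\<in>B. a * b)"
    and mult_le_inf: "a * b \<le> inf a b"
    and one_eq_top: "1 = top"

definition nilpotent :: "'a::multiplicative_lattice \<Rightarrow> bool"
  where "nilpotent a \<longleftrightarrow> (\<exists>n>0. a ^ n = bot)"

definition compact_element :: "'a::complete_lattice \<Rightarrow> bool"
  where "compact_element c \<longleftrightarrow> (\<forall>A. c \<le> Sup A \<longrightarrow> (\<exists>F. F \<subseteq> A \<and> finite F \<and> c \<le> Sup F))"

definition prime_element :: "'a::multiplicative_lattice \<Rightarrow> bool"
  where "prime_element p \<longleftrightarrow> p \<noteq> 1 \<and> (\<forall>a b. a * b \<le> p \<longrightarrow> a \<le> p \<or> b \<le> p)"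

definition minimal_prime :: "'a::multiplicative_lattice \<Rightarrow> bool"
  where "minimal_prime p \<longleftrightarrow> prime_element p \<and> (\<forall>q. prime_element q \<longrightarrow> q \<le> p \<longrightarrow> q = p)"

definition zd_vertices :: "'a::multiplicative_lattice set"
  where "zd_vertices = {x. x \<noteq> bot \<and> (\<exists>y. y \<noteq> bot \<and> x * y = bot)}"

definition zd_edges :: "'a::multiplicative_lattice set set"
  where "zd_edges = {{a, b} |a b. a \<in> zd_vertices \<and> b \<in> zd_vertices \<and> a \<noteq> b \<and> a * b = bot}"

text \<open>
  Graphs are given by a vertex set \<open>V\<close> and a set \<open>E\<close> of two-element edges. Both invariants take the
  value \<open>\<infinity>\<close> when they are not finite. An infinite complete subgraph has finite complete subgraphs
  of every size, so finite vertex sets suffice for the supremum defining the clique number. The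
  empty graph has clique number and chromatic number \<open>0\<close>. In particular, if \<open>bot\<close> is prime, the
  zero-divisor graph is empty and both numbers are \<open>0\<close>, although \<open>bot\<close> is then the one minimal
  prime, so equality with the number of minimal primes fails in that case.
\<close>

definition clique_number :: "'v set \<Rightarrow> 'v set set \<Rightarrow> enat"
  where "clique_number V E = (SUP S\<in>{S. S \<subseteq> V \<and> finite S \<and> clique S E}. enat (card S))"

definition colourable :: "'v set \<Rightarrow> 'v set set \<Rightarrow> nat \<Rightarrow> bool"
  where "colourable V E k \<longleftrightarrow>
    (\<exists>c :: 'v \<Rightarrow> nat. c ` V \<subseteq> {..<k} \<and> (\<forall>u\<in>V. \<forall>v\<in>V. {u, v} \<in> E \<longrightarrow> c u \<noteq> c v))"

definition chromatic_number :: "'v set \<Rightarrow> 'v set set \<Rightarrow> enat"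
  where "chromatic_number V E = (INF k\<in>{k. colourable V E k}. enat k)"

end

(* In a reduced multiplicative lattice, finiteness of the clique number bounds the size of sets of
   pairwise orthogonal nonzero elements. For such a set S of maximum size, the annihilator of each
   x in S is prime, since otherwise x could be split into two orthogonal nonzero multiples of
   itself, and the annihilators meet in 0, since otherwise S could be enlarged. Hence they are
   exactly the minimal primes. If S has at least two elements it is a maximum clique, and colouring
   each vertex by a member of S that does not annihilate it is a proper colouring. *)

theory Submission
  imports Defs
begin

lemma mult_bot [simp]: "a * bot = (bot :: 'a::multiplicative_lattice)"
  using mult_Sup[of a "{}"] by simp

lemma bot_mult [simp]: "bot * a = (bot :: 'a::multiplicative_lattice)"
  by (metis mult_bot mult.commute)

lemma mult_le_left: "a * b \<le> (a :: 'a::multiplicative_lattice)"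
  using mult_le_inf[of a b] by simp

lemma mult_left_mono_lattice: "b \<le> c \<Longrightarrow> a * b \<le> a * (c :: 'a::multiplicative_lattice)"
  using mult_Sup[of a "{b, c}"] by (metis SUP_upper Sup_insert cSup_singleton insertI1 sup.absorb2)

lemma prod_le_prime_element:
  assumes "finite A" "prime_element p" "prod f A \<le> (p :: 'a::multiplicative_lattice)"
  obtains x where "x \<in> A" "f x \<le> p"
  using assms(1,3)
proof (induction A arbitrary: thesis rule: finite_induct)
  case empty
  \<comment> \<open>The empty product is \<open>1 = top\<close>, which lies below no prime.\<close>
  with assms(2) show ?case by (simp add: prime_element_def one_eq_top top_unique)
next
  case (insert a A)
  then have "f a \<le> p \<or> prod f A \<le> p"
    using assms(2) by (simp add: prime_element_def)
  with insert show ?case by blast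
qed

text \<open>The residual (0 : x).\<close>

definition annihilator :: "'a::multiplicative_lattice \<Rightarrow> 'a"
  where "annihilator x = Sup {y. x * y = bot}"

text \<open>By distributivity over arbitrary joins, \<open>x\<close> still kills the join of
  everything it kills.\<close>

lemma le_annihilator_iff: "y \<le> annihilator x \<longleftrightarrow> x * y = bot"
proof
  have "x * annihilator x = bot"
    unfolding annihilator_def mult_Sup by (intro antisym SUP_least) auto
  moreover assume "y \<le> annihilator x"
  ultimately show "x * y = bot"
    by (metis mult_left_mono_lattice bot_unique)
qed (simp add: annihilator_def Sup_upper)

text \<open>Differs from a clique of the zero-divisor graph only in admitting \<open>{x}\<close> for
  a nonzero \<open>x\<close> that is not a zero divisor. This keeps the count of minimal primes
  right even when \<open>bot\<close> is prime.\<close>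

definition orthogonal_set :: "'a::multiplicative_lattice set \<Rightarrow> bool"
  where "orthogonal_set S \<longleftrightarrow> bot \<notin> S \<and> pairwise (\<lambda>x y. x * y = bot) S"

lemma orthogonal_set_insert:
  "orthogonal_set S \<Longrightarrow> y \<noteq> bot \<Longrightarrow> \<forall>x\<in>S. x \<noteq> y \<longrightarrow> x * y = bot \<Longrightarrow> orthogonal_set (insert y S)"
  by (auto simp: orthogonal_set_def pairwise_insert mult.commute)

lemma orthogonal_set_zd_clique:
  assumes "orthogonal_set (S :: 'a::multiplicative_lattice set)" "1 < card S"
  shows "S \<subseteq> zd_vertices" "clique S zd_edges"
proof -
  show V: "S \<subseteq> zd_vertices"
  proof
    fix x assume x: "x \<in> S"
    then obtain y where "y \<in> S" "x \<noteq> y"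
      \<comment> \<open>A second member of \<open>S\<close> witnesses that \<open>x\<close> is a
        zero divisor. Infinite sets have \<open>card\<close> 0, so \<open>S\<close> is finite
        here.\<close>
      using assms(2) by (metis One_nat_def card_le_Suc0_iff_eq card.infinite not_less not_less_zero)
    with x assms(1) show "x \<in> zd_vertices"
      unfolding orthogonal_set_def pairwise_def zd_vertices_def
      by (intro CollectI conjI exI[of _ y]) auto
  qed
  show "clique S zd_edges"
    using V assms(1) unfolding clique_def zd_edges_def orthogonal_set_def pairwise_def by blast
qed

lemma clique_card_le_clique_number:
  "S \<subseteq> V \<Longrightarrow> finite S \<Longrightarrow> clique S E \<Longrightarrow> enat (card S) \<le> clique_number V E"
  unfolding clique_number_def by (rule SUP_upper) simp

text \<open>A proper colouring is injective on every clique.\<close>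

lemma clique_number_le_colours:
  assumes "colourable V E k"
  shows "clique_number V E \<le> enat k"
  unfolding clique_number_def
proof (rule SUP_least)
  fix S assume "S \<in> {S. S \<subseteq> V \<and> finite S \<and> clique S E}"
  then have S: "S \<subseteq> V" "clique S E" by auto
  obtain c where c: "c ` V \<subseteq> {..<k}" "\<forall>u\<in>V. \<forall>v\<in>V. {u, v} \<in> E \<longrightarrow> c u \<noteq> c v"
    using assms by (auto simp: colourable_def)
  have "inj_on c S"
    using S c(2) by (fastforce simp: inj_on_def clique_def)
  moreover have "c ` S \<subseteq> {..<k}" using c(1) S(1) by blast
  ultimately show "enat (card S) \<le> enat k"
    using card_inj_on_le[of c S "{..<k}"] by simp
qed

lemma clique_number_le_chromatic_number: "clique_number V E \<le> chromatic_number V E"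
  unfolding chromatic_number_def by (rule INF_greatest) (simp add: clique_number_le_colours)

lemma chromatic_number_le: "colourable V E k \<Longrightarrow> chromatic_number V E \<le> enat k"
  unfolding chromatic_number_def by (rule INF_lower) simp

text \<open>Maximality is by cardinality rather than inclusion, because the primeness argument
  replaces one member by two others.\<close>

locale maximum_orthogonal_set =
  fixes S :: "'a::multiplicative_lattice set"
  assumes square_zero: "x * x = bot \<Longrightarrow> x = (bot :: 'a)"
    and finite: "finite S"
    and orthogonal: "orthogonal_set S"
    and maximum: "finite T \<Longrightarrow> orthogonal_set (T :: 'a set) \<Longrightarrow> card T \<le> card S"
begin

lemma nonzero: "x \<in> S \<Longrightarrow> x \<noteq> bot"
  using orthogonal by (auto simp: orthogonal_set_def)

lemma orthogonalD: "x \<in> S \<Longrightarrow> y \<in> S \<Longrightarrow> x \<noteq> y \<Longrightarrow> x * y = bot"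
  using orthogonal by (auto simp: orthogonal_set_def pairwise_def)

lemma prime_annihilator:
  assumes x: "x \<in> S"
  shows "prime_element (annihilator x)"
  unfolding prime_element_def
proof (intro conjI allI impI)
  show "annihilator x \<noteq> 1"
    using le_annihilator_iff[of 1 x] nonzero[OF x] by auto
next
  fix a b assume "a * b \<le> annihilator x"
  then have xab: "x * (a * b) = bot" by (simp add: le_annihilator_iff)
  show "a \<le> annihilator x \<or> b \<le> annihilator x"
  proof (rule ccontr)
    assume "\<not> ?thesis"
    then have nz: "x * a \<noteq> bot" "x * b \<noteq> bot" by (auto simp: le_annihilator_iff)
    have "(x * a) * (x * b) = x * (x * (a * b))" by (simp add: mult_ac)
    then have orth: "(x * a) * (x * b) = bot" using xab by simp
    \<comment> \<open>If they were equal, a nonzero element would have square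
      \<open>bot\<close>.\<close>
    have ne: "x * a \<noteq> x * b" using orth nz square_zero by metis
    have S': "orthogonal_set (S - {x})"
      using orthogonal by (auto simp: orthogonal_set_def pairwise_def)
    have zero: "y * (x * c) = bot" if "y \<in> S - {x}" for y c
      using that orthogonalD[of y x] x by (simp flip: mult.assoc)
    \<comment> \<open>Members of \<open>S - {x}\<close> are orthogonal to \<open>x * c\<close>, so
      membership would again give a vanishing square.\<close>
    have new: "x * c \<notin> S - {x}" if "x * c \<noteq> bot" for c
      using zero[of "x * c" c] square_zero that by blast
    \<comment> \<open>Trading \<open>x\<close> for two new members gives one element too
      many.\<close>
    let ?T = "insert (x * a) (insert (x * b) (S - {x}))"
    have "orthogonal_set ?T"
      using S' nz orth zero by (intro orthogonal_set_insert) (auto simp: mult.commute)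
    then have "card ?T \<le> card S" using finite by (intro maximum) auto
    moreover have "card ?T = Suc (card S)"
      using finite ne new nz card_Suc_Diff1[OF finite x] by (simp del: card_Diff_insert)
    ultimately show False by simp
  qed
qed

lemma eq_bot_if_le_annihilators:
  assumes "\<And>x. x \<in> S \<Longrightarrow> y \<le> annihilator x"
  shows "y = bot"
proof (rule ccontr)
  assume y: "y \<noteq> bot"
  have zero: "x * y = bot" if "x \<in> S" for x
    using assms[OF that] by (simp add: le_annihilator_iff)
  then have "y \<notin> S" using square_zero y by blast
  moreover have "orthogonal_set (insert y S)"
    using orthogonal y zero by (intro orthogonal_set_insert) auto
  ultimately show False using maximum[of "insert y S"] finite by simp
qed

text \<open>The product of the finitely many annihilators lies below each of them, hence is
  \<open>bot\<close> and below \<open>p\<close>; primeness of \<open>p\<close> selects a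
  factor.\<close>

lemma prime_above_annihilator:
  assumes "prime_element p"
  obtains x where "x \<in> S" "annihilator x \<le> p"
proof -
  have "prod annihilator S = bot"
  proof (rule eq_bot_if_le_annihilators)
    fix x assume "x \<in> S"
    then show "prod annihilator S \<le> annihilator x"
      using prod.remove[OF finite, of x annihilator] by (simp add: mult_le_left)
  qed
  then show thesis
    using prod_le_prime_element[OF finite assms, of annihilator] that by auto
qed

text \<open>For distinct members, \<open>x \<le> annihilator y \<le> annihilator x\<close> would
  make \<open>x * x\<close> vanish. The resulting antichain yields both minimality of these primes
  and injectivity of \<open>annihilator\<close> on \<open>S\<close>.\<close>

lemma annihilator_le_imp_eq:
  assumes "x \<in> S" "y \<in> S" "annihilator y \<le> annihilator x"
  shows "x = y"
proof (rule ccontr)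
  assume "x \<noteq> y"
  then have "x \<le> annihilator y"
    using assms orthogonalD by (simp add: le_annihilator_iff)
  then have "x * x = bot" using assms(3) by (metis order_trans le_annihilator_iff)
  then show False using square_zero nonzero assms(1) by blast
qed

lemma minimal_primes_eq: "{p. minimal_prime p} = annihilator ` S"
proof (intro set_eqI iffI)
  fix p :: 'a assume "p \<in> {p. minimal_prime p}"
  then have p: "minimal_prime p" by simp
  then obtain x where "x \<in> S" "annihilator x \<le> p"
    using prime_above_annihilator minimal_prime_def by metis
  then show "p \<in> annihilator ` S"
    using p prime_annihilator by (metis minimal_prime_def imageI)
next
  fix p :: 'a assume "p \<in> annihilator ` S"
  then obtain x where x: "x \<in> S" "p = annihilator x" by blast
  have "q = p" if q: "prime_element q" "q \<le> p" for q
  proof -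
    obtain y where y: "y \<in> S" "annihilator y \<le> q"
      using prime_above_annihilator q(1) by blast
    then have "x = y" using annihilator_le_imp_eq x q(2) order_trans by metis
    then show ?thesis using x y q(2) by simp
  qed
  then show "p \<in> {p. minimal_prime p}"
    using x prime_annihilator by (simp add: minimal_prime_def)
qed

lemma card_minimal_primes: "card {p::'a. minimal_prime p} = card S"
  unfolding minimal_primes_eq
  by (intro card_image inj_onI) (simp add: annihilator_le_imp_eq)

lemma colourable_zd: "colourable (zd_vertices :: 'a set) zd_edges (card S)"
proof -
  \<comment> \<open>The colours are really members of \<open>S\<close>; \<open>h\<close> only
    numbers them.\<close>
  obtain h where h: "bij_betw h S {..<card S}"
    using finite ex_bij_betw_finite_nat[of S] by (auto simp: atLeast0LessThan)
  have "\<exists>x\<in>S. \<not> v \<le> annihilator x" if "v \<in> zd_vertices" for v :: 'a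
    using eq_bot_if_le_annihilators that by (auto simp: zd_vertices_def)
  then obtain g where g: "\<And>v. v \<in> zd_vertices \<Longrightarrow> g v \<in> S \<and> \<not> v \<le> annihilator (g v)"
    by metis
  show ?thesis
    unfolding colourable_def
  proof (intro exI conjI ballI impI)
    show "(h \<circ> g) ` zd_vertices \<subseteq> {..<card S}"
      using g h by (auto simp: bij_betw_def)
  next
    fix u v :: 'a assume uv: "u \<in> zd_vertices" "v \<in> zd_vertices" "{u, v} \<in> zd_edges"
    then have "u * v = bot"
      by (auto simp: zd_edges_def doubleton_eq_iff mult.commute)
    then have "u * v \<le> annihilator (g u)" by simp
    \<comment> \<open>By choice of \<open>g\<close> the first alternative fails, so
      \<open>g u\<close> kills \<open>v\<close>, whereas \<open>g v\<close> does not.\<close>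
    then have "u \<le> annihilator (g u) \<or> v \<le> annihilator (g u)"
      using prime_annihilator g uv by (metis prime_element_def)
    then have "g u \<noteq> g v" using g uv by metis
    then show "(h \<circ> g) u \<noteq> (h \<circ> g) v"
      using g uv h by (auto simp: bij_betw_def inj_on_def)
  qed
qed

end

lemma ex_maximum_orthogonal_set:
  assumes "\<And>x :: 'a::multiplicative_lattice. x * x = bot \<Longrightarrow> x = bot"
    and "clique_number (zd_vertices :: 'a::multiplicative_lattice set) zd_edges < \<infinity>"
  obtains S :: "'a::multiplicative_lattice set" where "maximum_orthogonal_set S"
proof -
  obtain k where k: "clique_number (zd_vertices :: 'a set) zd_edges = enat k"
    using assms(2) by auto
  let ?P = "\<lambda>S::'a set. finite S \<and> orthogonal_set S"
  \<comment> \<open>The clique number \<open>k\<close> bounds sets with at least two members; the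
    \<open>1\<close> covers singletons, which need not be cliques of the graph.\<close>
  have "card S < Suc (max 1 k)" if "?P S" for S
  proof (cases "1 < card S")
    case True
    with that show ?thesis
      using clique_card_le_clique_number[of S zd_vertices zd_edges] orthogonal_set_zd_clique[of S] k
      by auto
  qed simp
  moreover have "?P {}" by (simp add: orthogonal_set_def)
  ultimately obtain S where "?P S" "\<forall>T. ?P T \<longrightarrow> card T \<le> card S"
    using ex_has_greatest_nat[of ?P "{}" card] by (metis less_imp_le)
  then have "maximum_orthogonal_set S"
    by unfold_locales (rule assms(1), assumption, blast+)
  then show thesis by (rule that)
qed

theorem theorem2p18:
  assumes reduced: "\<forall>a::'a::multiplicative_lattice. nilpotent a \<longleftrightarrow> a = bot"
    and one_compact: "compact_element (1::'a)"
    and compactly_generated: "\<forall>a::'a. \<exists>C. (\<forall>c\<in>C. compact_element c) \<and> a = Sup C"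
    and compact_mult: "\<forall>s t::'a. compact_element s \<longrightarrow> compact_element t \<longrightarrow> compact_element (s * t)"
    and clique_finite: "clique_number (zd_vertices :: 'a set) zd_edges < \<infinity>"
  shows "finite {p::'a. minimal_prime p} \<and>
    chromatic_number (zd_vertices :: 'a set) zd_edges = clique_number (zd_vertices :: 'a set) zd_edges \<and>
    (\<not> prime_element (bot::'a) \<longrightarrow> clique_number (zd_vertices :: 'a set) zd_edges = enat (card {p::'a. minimal_prime p}))"
proof -
  let ?V = "zd_vertices :: 'a set"
  have "x = bot" if "x * x = bot" for x :: 'a
    using reduced that by (metis nilpotent_def power2_eq_square zero_less_numeral)
  then obtain S :: "'a set" where "maximum_orthogonal_set S"
    using ex_maximum_orthogonal_set clique_finite by blast
  then interpret maximum_orthogonal_set S .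
  have fin: "finite {p::'a. minimal_prime p}"
    unfolding minimal_primes_eq using finite by simp
  have le: "clique_number ?V zd_edges \<le> chromatic_number ?V zd_edges"
    by (rule clique_number_le_chromatic_number)
  show ?thesis
  proof (cases "prime_element (bot::'a)")
    case True
    \<comment> \<open>A prime \<open>bot\<close> rules out zero divisors.\<close>
    then have "?V = {}" by (force simp: zd_vertices_def prime_element_def bot_unique)
    then have "colourable ?V zd_edges 0" by (simp add: colourable_def)
    then have "chromatic_number ?V zd_edges \<le> 0"
      using chromatic_number_le by (metis zero_enat_def)
    with fin le True show ?thesis by simp
  next
    case False
    have upper: "chromatic_number ?V zd_edges \<le> enat (card S)"
      by (rule chromatic_number_le[OF colourable_zd])
    \<comment> \<open>The annihilator of a sole member would be both prime and
      \<open>bot\<close>.\<close>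
    have "card S \<noteq> 1"
    proof
      assume "card S = 1"
      then obtain x where x: "S = {x}" by (auto simp: card_1_singleton_iff)
      then have "annihilator x = bot" by (intro eq_bot_if_le_annihilators) simp
      with x False show False using prime_annihilator[of x] by simp
    qed
    then have "enat (card S) \<le> clique_number ?V zd_edges"
    \<comment> \<open>An empty \<open>S\<close> occurs only in the one-element lattice; otherwise
      \<open>S\<close> has two members and is itself a clique of the graph.\<close>
    proof (cases "card S = 0")
      case True
      then show ?thesis by (simp flip: zero_enat_def)
    next
      case 1: False
      with \<open>card S \<noteq> 1\<close> have "1 < card S" by simp
      then show ?thesis
        using orthogonal_set_zd_clique[OF orthogonal] finite
        by (intro clique_card_le_clique_number) auto
    qed
    with fin le upper show ?thesis by (auto simp: card_minimal_primes)
  qed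
qed

end
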